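(* Let $\mathcal D$ be a family of upwards closed dependencies and let $\phi$ be a formula of $\mathrm{FO}(\mathcal D)$. Let $M$ be a first-order model and $X$, $Y$ teams over $M$ such that $X\subseteq Y$, $M\models_X\phi$ and $M\models_Y\phi^f$. Then $M\models_Y\phi$.
   Context: Team semantics: models have domain $\mathrm{dom}(M)$ with at least two elements. A team $X$ over $M$ with domain a finite set of variables $V$ is a set of assignments $s:V\to\mathrm{dom}(M)$; for a tuple $\bar x$ of variables in $V$, $X(\bar x)=\{s(\bar x): s\in X\}$. Formulas are in negation normal form, and $M\models_X\phi$ is defined by: for a first-order literal $\alpha$, $M\models_X\alpha$ iff every $s\in X$ satisfies $\alpha$ in the Tarskian sense; $M\models_X\psi\vee\theta$ iff $X=Y\cup Z$ for some $Y,Z$ with $M\models_Y\psi$ and $M\models_Z\theta$; $M\models_X\psi\wedge\theta$ iff both hold on $X$; $M\models_X\exists v\psi$ iff there is $H:X\to\mathcal P(\mathrm{dom}(M))\setminus\{\emptyset\}$ with $M\models_{X[H/v]}\psi$, where $X[H/v]=\{s[m/v]: s\in X, m\in H(s)\}$; $M\models_X\forall v\psi$ iff $M\models_{X[M/v]}\psi$, where $X[M/v]=\{s[m/v]: s\in X, m\in\mathrm{dom}(M)\}$. A dependency of arity $n$ is a class $\mathbf D$ of structures $(\mathrm{dom}(M),R)$, $R$ an $n$-ary relation, closed under isomorphism; the atom $\mathbf D\bar x$ is satisfied by $X$ in $M$ iff $(\mathrm{dom}(M),X(\bar x))\in\mathbf D$. $\mathrm{FO}(\mathcal D)$ is first-order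 logic extended with all atoms $\mathbf D\bar x$, $\mathbf D\in\mathcal D$. $\mathbf D$ is upwards closed if $(\mathrm{dom}(M),R)\in\mathbf D$ and $R\subseteq S$ imply $(\mathrm{dom}(M),S)\in\mathbf D$. The flattening $\phi^f$ is the first-order formula obtained from $\phi$ by replacing every dependency atom by the trivially true atom $\top$. *)

theory Defs
  imports "HOL-Library.NList"
begin

type_synonym var = nat

datatype 'f tm = Var var | Fn 'f "'f tm list"

datatype ('f, 'p) atm = Top | Eq "'f tm" "'f tm" | Rel 'p "'f tm list"

datatype ('f, 'p) literal = Pos "('f, 'p) atm" | Neg "('f, 'p) atm"

text \<open>
  The non-logical symbols are the elements of the domains of two partial maps, which give their
  arities. Hence either kind of symbol may be absent although types are nonempty.
\<close>

record ('f, 'p) signat =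
  funs :: "'f \<rightharpoonup> nat"
  rels :: "'p \<rightharpoonup> nat"

record ('f, 'p, 'a) model =
  Dom :: "'a set"
  fun_interp :: "'f \<Rightarrow> 'a list \<Rightarrow> 'a"
  rel_interp :: "'p \<Rightarrow> 'a list set"

definition two_elements :: "'a set \<Rightarrow> bool" where
  "two_elements A \<longleftrightarrow> (\<exists>a\<in>A. \<exists>b\<in>A. a \<noteq> b)"

definition is_model :: "('f, 'p) signat \<Rightarrow> ('f, 'p, 'a) model \<Rightarrow> bool" where
  "is_model \<Sigma> M \<longleftrightarrow>
     two_elements (Dom M) \<and>
     (\<forall>f n. funs \<Sigma> f = Some n \<longrightarrow> (\<forall>xs\<in>nlists n (Dom M). fun_interp M f xs \<in> Dom M)) \<and>
     (\<forall>p n. rels \<Sigma> p = Some n \<longrightarrow> rel_interp M p \<subseteq> nlists n (Dom M))"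

text \<open>
  A dependency is a class of structures \<open>(A, R)\<close>. Here \<open>A\<close> ranges over the subsets of a type \<open>'a\<close>,
  which is left arbitrary and is also the type of the elements of the model under consideration.
  All structures have at least two elements, as models do.
\<close>

record 'a dependency =
  arity :: nat
  structures :: "('a set \<times> 'a list set) set"

definition is_structure :: "nat \<Rightarrow> 'a set \<times> 'a list set \<Rightarrow> bool" where
  "is_structure n = (\<lambda>(A, R). two_elements A \<and> R \<subseteq> nlists n A)"

definition isomorphic :: "nat \<Rightarrow> 'a set \<times> 'a list set \<Rightarrow> 'a set \<times> 'a list set \<Rightarrow> bool" where
  "isomorphic n = (\<lambda>(A, R) (B, S).
     \<exists>f. bij_betw f A B \<and> (\<forall>xs\<in>nlists n A. xs \<in> R \<longleftrightarrow> map f xs \<in> S))"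

definition is_dependency :: "'a dependency \<Rightarrow> bool" where
  "is_dependency D \<longleftrightarrow>
     (\<forall>\<A>\<in>structures D. is_structure (arity D) \<A>) \<and>
     (\<forall>\<A>\<in>structures D. \<forall>\<B>. is_structure (arity D) \<B> \<and> isomorphic (arity D) \<A> \<B>
        \<longrightarrow> \<B> \<in> structures D)"

definition upwards_closed :: "'a dependency \<Rightarrow> bool" where
  "upwards_closed D \<longleftrightarrow>
     (\<forall>A R S. (A, R) \<in> structures D \<and> R \<subseteq> S \<and> is_structure (arity D) (A, S)
        \<longrightarrow> (A, S) \<in> structures D)"

datatype ('f, 'p, 'a) fm =
    Lit "('f, 'p) literal"
  | Dep "'a dependency" "var list"
  | Or "('f, 'p, 'a) fm" "('f, 'p, 'a) fm"
  | And "('f, 'p, 'a) fm" "('f, 'p, 'a) fm"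
  | Exi var "('f, 'p, 'a) fm"
  | All var "('f, 'p, 'a) fm"

primrec wf_tm :: "('f, 'p) signat \<Rightarrow> 'f tm \<Rightarrow> bool" where
  "wf_tm \<Sigma> (Var x) \<longleftrightarrow> True"
| "wf_tm \<Sigma> (Fn f ts) \<longleftrightarrow> funs \<Sigma> f = Some (length ts) \<and> list_all (wf_tm \<Sigma>) ts"

primrec wf_atm :: "('f, 'p) signat \<Rightarrow> ('f, 'p) atm \<Rightarrow> bool" where
  "wf_atm \<Sigma> Top \<longleftrightarrow> True"
| "wf_atm \<Sigma> (Eq t u) \<longleftrightarrow> wf_tm \<Sigma> t \<and> wf_tm \<Sigma> u"
| "wf_atm \<Sigma> (Rel p ts) \<longleftrightarrow> rels \<Sigma> p = Some (length ts) \<and> list_all (wf_tm \<Sigma>) ts"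

primrec wf_literal :: "('f, 'p) signat \<Rightarrow> ('f, 'p) literal \<Rightarrow> bool" where
  "wf_literal \<Sigma> (Pos a) \<longleftrightarrow> wf_atm \<Sigma> a"
| "wf_literal \<Sigma> (Neg a) \<longleftrightarrow> wf_atm \<Sigma> a"

text \<open>The formulas of \<open>FO(\<D>)\<close> over the signature \<open>\<Sigma>\<close>; \<open>FO \<Sigma> {}\<close> is first-order logic.\<close>

inductive_set FO :: "('f, 'p) signat \<Rightarrow> 'a dependency set \<Rightarrow> ('f, 'p, 'a) fm set"
  for \<Sigma> :: "('f, 'p) signat" and \<D> :: "'a dependency set" where
  "wf_literal \<Sigma> l \<Longrightarrow> Lit l \<in> FO \<Sigma> \<D>"
| "D \<in> \<D> \<Longrightarrow> length xs = arity D \<Longrightarrow> Dep D xs \<in> FO \<Sigma> \<D>"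
| "\<phi> \<in> FO \<Sigma> \<D> \<Longrightarrow> \<psi> \<in> FO \<Sigma> \<D> \<Longrightarrow> Or \<phi> \<psi> \<in> FO \<Sigma> \<D>"
| "\<phi> \<in> FO \<Sigma> \<D> \<Longrightarrow> \<psi> \<in> FO \<Sigma> \<D> \<Longrightarrow> And \<phi> \<psi> \<in> FO \<Sigma> \<D>"
| "\<phi> \<in> FO \<Sigma> \<D> \<Longrightarrow> Exi v \<phi> \<in> FO \<Sigma> \<D>"
| "\<phi> \<in> FO \<Sigma> \<D> \<Longrightarrow> All v \<phi> \<in> FO \<Sigma> \<D>"

primrec fv_tm :: "'f tm \<Rightarrow> var set" where
  "fv_tm (Var x) = {x}"
| "fv_tm (Fn f ts) = \<Union>(set (map fv_tm ts))"

primrec fv_atm :: "('f, 'p) atm \<Rightarrow> var set" where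
  "fv_atm Top = {}"
| "fv_atm (Eq t u) = fv_tm t \<union> fv_tm u"
| "fv_atm (Rel p ts) = \<Union>(fv_tm ` set ts)"

primrec fv_literal :: "('f, 'p) literal \<Rightarrow> var set" where
  "fv_literal (Pos a) = fv_atm a"
| "fv_literal (Neg a) = fv_atm a"

primrec fv :: "('f, 'p, 'a) fm \<Rightarrow> var set" where
  "fv (Lit l) = fv_literal l"
| "fv (Dep D xs) = set xs"
| "fv (Or \<phi> \<psi>) = fv \<phi> \<union> fv \<psi>"
| "fv (And \<phi> \<psi>) = fv \<phi> \<union> fv \<psi>"
| "fv (Exi v \<phi>) = fv \<phi> - {v}"
| "fv (All v \<phi>) = fv \<phi> - {v}"

text \<open>
  An assignment with domain \<open>V\<close> is a partial map with \<open>dom s = V\<close>. It is only applied to variables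
  in \<open>V\<close>, so the unspecified value of \<open>the None\<close> plays no role.
\<close>

type_synonym 'a assignment = "var \<rightharpoonup> 'a"
type_synonym 'a team = "'a assignment set"

definition is_team :: "('f, 'p, 'a) model \<Rightarrow> var set \<Rightarrow> 'a team \<Rightarrow> bool" where
  "is_team M V X \<longleftrightarrow> finite V \<and> (\<forall>s\<in>X. dom s = V \<and> ran s \<subseteq> Dom M)"

definition team_rel :: "'a team \<Rightarrow> var list \<Rightarrow> 'a list set" where
  "team_rel X xs = (\<lambda>s. map (\<lambda>x. the (s x)) xs) ` X"

definition supplement :: "'a team \<Rightarrow> ('a assignment \<Rightarrow> 'a set) \<Rightarrow> var \<Rightarrow> 'a team" where
  "supplement X H v = {s(v \<mapsto> m) | s m. s \<in> X \<and> m \<in> H s}"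

definition duplicate :: "'a team \<Rightarrow> ('f, 'p, 'a) model \<Rightarrow> var \<Rightarrow> 'a team" where
  "duplicate X M v = {s(v \<mapsto> m) | s m. s \<in> X \<and> m \<in> Dom M}"

primrec eval :: "('f, 'p, 'a) model \<Rightarrow> 'a assignment \<Rightarrow> 'f tm \<Rightarrow> 'a" where
  "eval M s (Var x) = the (s x)"
| "eval M s (Fn f ts) = fun_interp M f (map (eval M s) ts)"

primrec sat_atm :: "('f, 'p, 'a) model \<Rightarrow> 'a assignment \<Rightarrow> ('f, 'p) atm \<Rightarrow> bool" where
  "sat_atm M s Top \<longleftrightarrow> True"
| "sat_atm M s (Eq t u) \<longleftrightarrow> eval M s t = eval M s u"
| "sat_atm M s (Rel p ts) \<longleftrightarrow> map (eval M s) ts \<in> rel_interp M p"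

primrec sat_literal :: "('f, 'p, 'a) model \<Rightarrow> 'a assignment \<Rightarrow> ('f, 'p) literal \<Rightarrow> bool" where
  "sat_literal M s (Pos a) \<longleftrightarrow> sat_atm M s a"
| "sat_literal M s (Neg a) \<longleftrightarrow> \<not> sat_atm M s a"

primrec team_sat :: "('f, 'p, 'a) model \<Rightarrow> 'a team \<Rightarrow> ('f, 'p, 'a) fm \<Rightarrow> bool" where
  "team_sat M X (Lit l) \<longleftrightarrow> (\<forall>s\<in>X. sat_literal M s l)"
| "team_sat M X (Dep D xs) \<longleftrightarrow> (Dom M, team_rel X xs) \<in> structures D"
| "team_sat M X (Or \<phi> \<psi>) \<longleftrightarrow> (\<exists>Y Z. X = Y \<union> Z \<and> team_sat M Y \<phi> \<and> team_sat M Z \<psi>)"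
| "team_sat M X (And \<phi> \<psi>) \<longleftrightarrow> team_sat M X \<phi> \<and> team_sat M X \<psi>"
| "team_sat M X (Exi v \<phi>) \<longleftrightarrow>
     (\<exists>H. (\<forall>s\<in>X. H s \<subseteq> Dom M \<and> H s \<noteq> {}) \<and> team_sat M (supplement X H v) \<phi>)"
| "team_sat M X (All v \<phi>) \<longleftrightarrow> team_sat M (duplicate X M v) \<phi>"

primrec flatten :: "('f, 'p, 'a) fm \<Rightarrow> ('f, 'p, 'a) fm" where
  "flatten (Lit l) = Lit l"
| "flatten (Dep D xs) = Lit (Pos Top)"
| "flatten (Or \<phi> \<psi>) = Or (flatten \<phi>) (flatten \<psi>)"
| "flatten (And \<phi> \<psi>) = And (flatten \<phi>) (flatten \<psi>)"
| "flatten (Exi v \<phi>) = Exi v (flatten \<phi>)"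
| "flatten (All v \<phi>) = All v (flatten \<phi>)"

lemma flatten_first_order:
  assumes "\<phi> \<in> FO \<Sigma> \<D>"
  shows "flatten \<phi> \<in> FO \<Sigma> {}"
  using assms by induction (auto intro: FO.intros)

end

theory Submission
  imports Defs
begin

text \<open>
  Induction on \<open>\<phi>\<close>. At a disjunction or an existential quantifier, the witnesses (a splitting, or a
  choice function) for \<open>\<phi>\<close> on \<open>X\<close> and for its flattening on \<open>Y\<close> are merged by taking unions: the
  merged witness on \<open>Y\<close> extends the one on \<open>X\<close>, and it still satisfies the flattening because
  \<open>\<phi>\<close> implies its flattening and flattenings are preserved by unions of teams.
\<close>

lemma duplicate_Un: "duplicate (X \<union> Y) M v = duplicate X M v \<union> duplicate Y M v"
  by (auto simp: duplicate_def)

text \<open>The merged choice function takes the union of both value sets. The guards are essential: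
  \<open>H\<close> is unconstrained outside \<open>X\<close> and \<open>K\<close> outside
  \<open>Y\<close>, so a plain union \<open>H s \<union> K s\<close> could bring in assignments that
  lie in neither supplement.\<close>

lemma supplement_Un:
  fixes X Y :: "'a team"
  shows "supplement (X \<union> Y) (\<lambda>s. (if s \<in> X then H s else {}) \<union> (if s \<in> Y then K s else {})) v
    = supplement X H v \<union> supplement Y K v"
proof -
  have "supplement Z L v = (\<Union>s\<in>Z. (\<lambda>m. s(v \<mapsto> m)) ` L s)" for Z :: "'a team" and L
    by (auto simp: supplement_def)
  then show ?thesis
    by (auto split: if_splits)
qed

lemma is_team_duplicate:
  assumes "is_team M V X"
  shows "is_team M (insert v V) (duplicate X M v)"
  unfolding is_team_def
proof (intro conjI ballI)
  show "finite (insert v V)"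
    using assms by (simp add: is_team_def)
next
  fix t
  assume "t \<in> duplicate X M v"
  then obtain s m where t: "t = s(v \<mapsto> m)" and "s \<in> X" "m \<in> Dom M"
    by (auto simp: duplicate_def)
  then have "dom s = V" "ran s \<subseteq> Dom M"
    using assms by (auto simp: is_team_def)
  with \<open>m \<in> Dom M\<close> show "dom t = insert v V" "ran t \<subseteq> Dom M"
    unfolding t by (auto simp: ran_def)
qed

text \<open>A supplement with values in \<open>Dom M\<close> is a subteam of the duplicated team,
  and subsets of a team with domain \<open>V\<close> are again such teams.\<close>

lemma is_team_supplement:
  assumes "is_team M V X" and "\<And>s. s \<in> X \<Longrightarrow> H s \<subseteq> Dom M"
  shows "is_team M (insert v V) (supplement X H v)"
proof -
  have "supplement X H v \<subseteq> duplicate X M v"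
    using assms(2) by (auto simp: supplement_def duplicate_def)
  with is_team_duplicate[OF assms(1), of v] show ?thesis
    unfolding is_team_def by (meson subsetD)
qed

text \<open>The same splittings and choice functions serve as witnesses, and atoms only become
  weaker.\<close>

lemma team_sat_flatten: "team_sat M X \<phi> \<Longrightarrow> team_sat M X (flatten \<phi>)"
proof (induction \<phi> arbitrary: X)
  case (Or \<phi> \<psi>)
  then show ?case
    unfolding team_sat.simps flatten.simps by blast
next
  case (Exi v \<phi>)
  then show ?case
    unfolding team_sat.simps flatten.simps by blast
qed simp_all

lemma team_sat_ExiI:
  assumes "\<And>s. s \<in> X \<Longrightarrow> H s \<subseteq> Dom M \<and> H s \<noteq> {}" and "team_sat M (supplement X H v) \<phi>"
  shows "team_sat M X (Exi v \<phi>)"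
  using assms by auto

text \<open>Literals are checked one assignment at a time, so they survive unions; splittings are
  merged componentwise and choice functions as in \<open>supplement_Un\<close>.\<close>

lemma flatten_union_closed:
  assumes "team_sat M X (flatten \<phi>)" and "team_sat M Y (flatten \<phi>)"
  shows "team_sat M (X \<union> Y) (flatten \<phi>)"
  using assms
proof (induction \<phi> arbitrary: X Y)
  case (Or \<phi> \<psi>)
  from Or.prems obtain X1 X2 Y1 Y2 where XY: "X = X1 \<union> X2" "Y = Y1 \<union> Y2"
    and "team_sat M X1 (flatten \<phi>)" "team_sat M Y1 (flatten \<phi>)"
    and "team_sat M X2 (flatten \<psi>)" "team_sat M Y2 (flatten \<psi>)"
    unfolding flatten.simps team_sat.simps by blast
  then have "team_sat M (X1 \<union> Y1) (flatten \<phi>)" "team_sat M (X2 \<union> Y2) (flatten \<psi>)"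
    using Or.IH by simp_all
  moreover have "X \<union> Y = (X1 \<union> Y1) \<union> (X2 \<union> Y2)"
    using XY by auto
  ultimately show ?case
    unfolding flatten.simps team_sat.simps by blast
next
  case (Exi v \<phi>)
  from Exi.prems obtain H K where H: "\<forall>s\<in>X. H s \<subseteq> Dom M \<and> H s \<noteq> {}"
    and K: "\<forall>s\<in>Y. K s \<subseteq> Dom M \<and> K s \<noteq> {}"
    and sat: "team_sat M (supplement X H v) (flatten \<phi>)"
      "team_sat M (supplement Y K v) (flatten \<phi>)"
    unfolding flatten.simps team_sat.simps by blast
  define L where "L = (\<lambda>s. (if s \<in> X then H s else {}) \<union> (if s \<in> Y then K s else {}))"
  from sat have "team_sat M (supplement X H v \<union> supplement Y K v) (flatten \<phi>)"
    using Exi.IH by simp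
  then have sat: "team_sat M (supplement (X \<union> Y) L v) (flatten \<phi>)"
    unfolding L_def supplement_Un .
  have "L s \<subseteq> Dom M \<and> L s \<noteq> {}" if "s \<in> X \<union> Y" for s
    using H K that by (auto simp: L_def)
  then have "team_sat M (X \<union> Y) (Exi v (flatten \<phi>))"
    using sat by (rule team_sat_ExiI)
  then show ?case
    by simp
qed (simp_all add: duplicate_Un ball_Un)

text \<open>Upward closure applies only between structures, so \<open>team_rel Y xs\<close> must
  first be seen to consist of tuples of the right length over \<open>Dom M\<close>. As
  \<open>set xs \<subseteq> V\<close>, every \<open>the (s x)\<close> involved is a genuine value of
  \<open>s\<close>.\<close>

lemma team_sat_Dep_mono:
  assumes "upwards_closed D" and "two_elements (Dom M)" and "is_team M V Y"
    and "length xs = arity D" and "set xs \<subseteq> V" and "X \<subseteq> Y" and "team_sat M X (Dep D xs)"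
  shows "team_sat M Y (Dep D xs)"
proof -
  have "the (s x) \<in> Dom M" if "s \<in> Y" "x \<in> set xs" for s x
  proof -
    from that assms(3,5) have "x \<in> dom s" and "ran s \<subseteq> Dom M"
      by (auto simp: is_team_def)
    then show ?thesis
      by (auto simp: ran_def)
  qed
  then have "team_rel Y xs \<subseteq> nlists (arity D) (Dom M)"
    unfolding team_rel_def by (intro image_subsetI nlistsI) (auto simp: assms(4))
  then have "is_structure (arity D) (Dom M, team_rel Y xs)"
    using assms(2) by (simp add: is_structure_def)
  moreover have "team_rel X xs \<subseteq> team_rel Y xs"
    using \<open>X \<subseteq> Y\<close> unfolding team_rel_def by (rule image_mono)
  ultimately show ?thesis
    using assms(1,7) unfolding upwards_closed_def team_sat.simps by blast
qed

theorem theorem3p9: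
  fixes \<Sigma> :: "('f, 'p) signat"
    and \<D> :: "'a dependency set"
    and \<phi> :: "('f, 'p, 'a) fm"
    and M :: "('f, 'p, 'a) model"
    and V :: "var set"
    and X Y :: "'a team"
  assumes "\<forall>D\<in>\<D>. is_dependency D \<and> upwards_closed D"
    and "\<phi> \<in> FO \<Sigma> \<D>"
    and "is_model \<Sigma> M"
    and "is_team M V X"
    and "is_team M V Y"
    and "fv \<phi> \<subseteq> V"
    and "X \<subseteq> Y"
    and "team_sat M X \<phi>"
    and "team_sat M Y (flatten \<phi>)"
  shows "team_sat M Y \<phi>"
  \<comment> \<open>Rule induction on membership in \<open>FO\<close>. \<open>V\<close> is
    generalised along with the teams because a quantifier adds its variable to their domain.\<close>
  using assms(2,5-)
proof (induction arbitrary: V X Y)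
  case (1 l)
  then show ?case by simp
next
  case (2 D xs)
  then show ?case
    using assms(1,3) by (intro team_sat_Dep_mono[of D M V Y xs X]) (auto simp: is_model_def)
next
  case (3 \<phi> \<psi>)
  from "3.prems" obtain X1 X2 Y1 Y2 where XY: "X = X1 \<union> X2" "Y = Y1 \<union> Y2"
    and sat: "team_sat M X1 \<phi>" "team_sat M Y1 (flatten \<phi>)"
      "team_sat M X2 \<psi>" "team_sat M Y2 (flatten \<psi>)"
    by auto
  \<comment> \<open>Adding the parts of \<open>X\<close> to those of \<open>Y\<close> still splits
    \<open>Y\<close>, as \<open>X \<subseteq> Y\<close>; now each part contains the matching part of
    \<open>X\<close>, as the induction hypothesis requires.\<close>
  have Y: "Y = (X1 \<union> Y1) \<union> (X2 \<union> Y2)"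
    using XY \<open>X \<subseteq> Y\<close> by auto
  with \<open>is_team M V Y\<close> have "is_team M V (X1 \<union> Y1)" "is_team M V (X2 \<union> Y2)"
    by (auto simp: is_team_def)
  moreover have "team_sat M (X1 \<union> Y1) (flatten \<phi>)" "team_sat M (X2 \<union> Y2) (flatten \<psi>)"
    using sat by (auto intro!: flatten_union_closed dest: team_sat_flatten)
  ultimately have "team_sat M (X1 \<union> Y1) \<phi>" "team_sat M (X2 \<union> Y2) \<psi>"
    using "3.IH"(1)[of V "X1 \<union> Y1" X1] "3.IH"(2)[of V "X2 \<union> Y2" X2] "3.prems"(2) sat
    by auto
  with Y show ?case
    unfolding team_sat.simps by blast
next
  case (4 \<phi> \<psi>)
  from "4.IH"[of V Y X] "4.prems" show ?case
    by simp
next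
  case (5 \<phi> v)
  from "5.prems" obtain H K where H: "\<forall>s\<in>X. H s \<subseteq> Dom M \<and> H s \<noteq> {}"
    and K: "\<forall>s\<in>Y. K s \<subseteq> Dom M \<and> K s \<noteq> {}"
    and sat: "team_sat M (supplement X H v) \<phi>" "team_sat M (supplement Y K v) (flatten \<phi>)"
    by auto
  \<comment> \<open>On \<open>Y\<close> the values of \<open>K\<close> keep \<open>L s\<close>
    nonempty; on \<open>X\<close> the values of \<open>H\<close> are included, so supplementing
    \<open>Y\<close> by \<open>L\<close> extends supplementing \<open>X\<close> by
    \<open>H\<close>.\<close>
  define L where "L = (\<lambda>s. (if s \<in> X then H s else {}) \<union> (if s \<in> Y then K s else {}))"
  have L: "L s \<subseteq> Dom M \<and> L s \<noteq> {}" if "s \<in> Y" for s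
    using H K that by (auto simp: L_def)
  have un: "supplement Y L v = supplement X H v \<union> supplement Y K v"
    using supplement_Un[of X Y H K v] \<open>X \<subseteq> Y\<close> by (simp add: L_def Un_absorb1)
  have "team_sat M (supplement Y L v) \<phi>"
  proof (rule "5.IH")
    show "is_team M (insert v V) (supplement Y L v)"
      using "5.prems"(1) L by (intro is_team_supplement) auto
    show "fv \<phi> \<subseteq> insert v V"
      using "5.prems"(2) by auto
    show "team_sat M (supplement Y L v) (flatten \<phi>)"
      unfolding un using sat by (simp add: flatten_union_closed team_sat_flatten)
    show "supplement X H v \<subseteq> supplement Y L v"
      unfolding un by simp
  qed (rule sat)
  with L show ?case
    by (rule team_sat_ExiI)
next
  case (6 \<phi> v)
  \<comment> \<open>Nothing is chosen here: duplication is monotone in the team, so the induction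
    hypothesis applies to the duplicated teams directly.\<close>
  have "team_sat M (duplicate Y M v) \<phi>"
  proof (rule "6.IH")
    show "is_team M (insert v V) (duplicate Y M v)"
      using "6.prems"(1) by (rule is_team_duplicate)
    show "duplicate X M v \<subseteq> duplicate Y M v"
      using \<open>X \<subseteq> Y\<close> by (auto simp: duplicate_def)
  qed (use "6.prems" in auto)
  then show ?case
    by simp
qed

end
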